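(* Let $\ell\in\{1,2,3,4\}$. The game $K^\ell$ has no redundant move: for every single move $m\in\{(i,0),(0,i),(i,i): i\ge 1\}$, removing $m$ from the rule-set changes the set of $\mathcal{P}$-positions.
   Context: Positions are pairs $(x,y)\in\mathbb{N}^2$. The rule-set of Wythoff moves is $\{(i,0),(0,i),(i,i): i\ge1\}$; playing move $(u,v)$ from $(x,y)$ leads to $(x-u,y-v)$, provided both coordinates remain nonnegative. For $\ell\in\mathbb{N}$, $K^\ell$ is the two-player impartial game with these moves in which the positions of $\{(x,y):x+y\le\ell\}$ are terminal: no move is allowed from a terminal position, and a player who moves into a terminal position wins (normal play). A $\mathcal{P}$-position is a position from which the previous player has a winning strategy. A move is redundant if removing it from the rule-set (keeping everything else, including the terminal set, unchanged) does not change the set of $\mathcal{P}$-positions. *)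

theory Defs
  imports Main
begin

type_synonym pos = "nat \<times> nat"

definition wythoff_moves :: "(nat \<times> nat) set" where
  "wythoff_moves = {(i, 0) | i. i \<ge> 1} \<union> {(0, i) | i. i \<ge> 1} \<union> {(i, i) | i. i \<ge> 1}"

definition terminal :: "nat \<Rightarrow> pos set" where
  "terminal l = {(x, y). x + y \<le> l}"

text \<open>
  The game with rule-set \<open>R\<close> and terminal set \<^term>\<open>terminal l\<close>; \<open>K\<close> with parameter \<open>l\<close> is the
  case \<^term>\<open>R = wythoff_moves\<close>.
\<close>

definition options :: "(nat \<times> nat) set \<Rightarrow> nat \<Rightarrow> pos \<Rightarrow> pos set" where
  "options R l = (\<lambda>(x, y). if (x, y) \<in> terminal l then {}
     else {(x - u, y - v) | u v. (u, v) \<in> R \<and> u \<le> x \<and> v \<le> y})"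

text \<open>
  A completed play, as the nonempty list of positions visited. If \<open>(0, 0) \<notin> R\<close>, every move
  decreases \<open>x + y\<close>, so all plays are finite and lists suffice.
\<close>

definition complete_play :: "(nat \<times> nat) set \<Rightarrow> nat \<Rightarrow> pos list \<Rightarrow> bool" where
  "complete_play R l ps \<longleftrightarrow> ps \<noteq> [] \<and>
     (\<forall>i. Suc i < length ps \<longrightarrow> ps ! Suc i \<in> options R l (ps ! i)) \<and>
     options R l (last ps) = {}"

definition legal_strategy :: "(nat \<times> nat) set \<Rightarrow> nat \<Rightarrow> (pos \<Rightarrow> pos) \<Rightarrow> bool" where
  "legal_strategy R l \<sigma> \<longleftrightarrow> (\<forall>p. options R l p \<noteq> {} \<longrightarrow> \<sigma> p \<in> options R l p)"

text \<open>
  The player to move at the first position (the next player) moves at even indices, the previous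
  player at odd ones.
\<close>

definition previous_follows :: "(pos \<Rightarrow> pos) \<Rightarrow> pos list \<Rightarrow> bool" where
  "previous_follows \<sigma> ps \<longleftrightarrow> (\<forall>i. Suc i < length ps \<and> odd i \<longrightarrow> ps ! Suc i = \<sigma> (ps ! i))"

text \<open>
  Normal play: whoever cannot move loses. A completed play \<open>ps\<close> has \<open>length ps - 1\<close> moves, so the
  previous player wins it iff \<open>length ps\<close> is odd.
\<close>

definition P_position :: "(nat \<times> nat) set \<Rightarrow> nat \<Rightarrow> pos \<Rightarrow> bool" where
  "P_position R l p \<longleftrightarrow> (\<exists>\<sigma>. legal_strategy R l \<sigma> \<and>
     (\<forall>ps. complete_play R l ps \<and> hd ps = p \<and> previous_follows \<sigma> ps \<longrightarrow> odd (length ps)))"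

definition redundant :: "(nat \<times> nat) set \<Rightarrow> nat \<Rightarrow> nat \<times> nat \<Rightarrow> bool" where
  "redundant R l m \<longleftrightarrow> m \<in> R \<and> {p. P_position (R - {m}) l p} = {p. P_position R l p}"

end

theory Submission
  imports Defs
begin

text \<open>
  The \<open>P\<close>-positions outside the terminal set are the pairs \<open>(a n, b n)\<close> (written
  \<open>lo l n\<close>, \<open>hi l n\<close> below) and their mirror images, where \<open>b n = a n + l + 1 + n\<close> and the two sequences partition the integers above \<open>l\<close>. A move is
  not redundant as soon as some position reaches a \<open>P\<close>-position by this move only. For \<open>(i, 0)\<close>
  the position \<open>(b 0 + i, a 0)\<close> has this property. For \<open>(i, i)\<close> the position \<open>(a n + i, b n + i)\<close>
  has it if both coordinates are values of \<open>a\<close>.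

  To find such an \<open>n\<close>, encode the two sequences by the infinite word \<open>w\<close> over \<open>{a, b}\<close>, read from
  \<open>l + 1\<close> on. It satisfies \<open>w = a\<^sup>l\<^sup>+\<^sup>1 \<sigma>(w)\<close> for the Fibonacci morphism \<open>\<sigma>(a) = ba\<close>,
  \<open>\<sigma>(b) = a\<close>, and \<open>b n\<close> begins the image of the letter at \<open>a n\<close>. Let \<open>f = a \<sigma>(f)\<close> be the
  Fibonacci word. By induction \<open>w\<close> contains both \<open>a u\<close> and \<open>ab u\<close> for each prefix \<open>u\<close> of \<open>f\<close>. If
  the first letter of the occurrence is \<open>a n\<close>, then \<open>a n\<close> and \<open>b n\<close> are followed by the same
  letters of \<open>f\<close>, directly in the first case and with a delay of one letter in the second. As \<open>f\<close>
  has no factor \<open>bb\<close>, one of the two cases shows the letter \<open>a\<close> at distance \<open>i\<close>.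
\<close>

section \<open>Kernels\<close>

text \<open>Kernel of the option graph: left to right is independence, right to left is absorption.
  This local condition replaces strategies in everything that follows.\<close>

definition is_kernel :: "(nat \<times> nat) set \<Rightarrow> nat \<Rightarrow> pos set \<Rightarrow> bool" where
  "is_kernel R l S \<longleftrightarrow> (\<forall>p. p \<in> S \<longleftrightarrow> options R l p \<inter> S = {})"

lemma is_kernelD: "is_kernel R l S \<Longrightarrow> p \<in> S \<longleftrightarrow> options R l p \<inter> S = {}"
  unfolding is_kernel_def by blast

lemma options_decrease:
  assumes "(0, 0) \<notin> R" "q \<in> options R l p"
  shows "fst q + snd q < fst p + snd p"
proof -
  obtain x y where p: "p = (x, y)" by (cases p)
  obtain u v where uv: "q = (x - u, y - v)" "(u, v) \<in> R" "u \<le> x" "v \<le> y"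
    using assms(2) by (auto simp: options_def p split: if_splits)
  have "u \<noteq> 0 \<or> v \<noteq> 0" using uv(2) assms(1) by metis
  then show ?thesis using uv(1,3,4) p by auto
qed

text \<open>The guard \<open>fst q + snd q < \<dots>\<close> only serves termination: by \<open>options_decrease\<close> it
  always holds if \<open>(0, 0) \<notin> R\<close>.\<close>

function losing :: "(nat \<times> nat) set \<Rightarrow> nat \<Rightarrow> pos \<Rightarrow> bool" where
  "losing R l p \<longleftrightarrow>
     (\<forall>q. q \<in> options R l p \<longrightarrow> fst q + snd q < fst p + snd p \<longrightarrow> \<not> losing R l q)"
  by auto
termination
  by (relation "measure (\<lambda>(R, l, p). fst p + snd p)") auto

declare losing.simps [simp del]

lemma kernel_exists:
  assumes "(0, 0) \<notin> R"
  shows "\<exists>S. is_kernel R l S"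
proof
  show "is_kernel R l {p. losing R l p}"
    unfolding is_kernel_def using options_decrease[OF assms] losing.simps[of R l] by blast
qed

text \<open>The previous player returns to \<open>S\<close> whenever the next player leaves it, so
  \<open>S\<close> is visited exactly at even indices. A stuck position lies in \<open>S\<close>
  vacuously, hence the play ends at an even index.\<close>

lemma kernel_imp_P_position:
  assumes S: "is_kernel R l S" and p: "p \<in> S"
  shows "P_position R l p"
proof -
  \<comment> \<open>Legality is demanded at every position with options, so an arbitrary option
    serves where \<open>S\<close> is out of reach.\<close>
  define \<sigma> where "\<sigma> = (\<lambda>p. if options R l p \<inter> S = {} then SOME q. q \<in> options R l p
                            else SOME q. q \<in> options R l p \<inter> S)"
  have \<sigma>S: "\<sigma> q \<in> options R l q \<inter> S" if "q \<notin> S" for q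
  proof -
    have "options R l q \<inter> S \<noteq> {}" using is_kernelD[OF S] that by blast
    then show ?thesis unfolding \<sigma>_def by (metis (mono_tags, lifting) ex_in_conv someI_ex)
  qed
  have legal: "legal_strategy R l \<sigma>"
    unfolding legal_strategy_def
  proof (intro allI impI)
    fix q assume ne: "options R l q \<noteq> {}"
    show "\<sigma> q \<in> options R l q"
    proof (cases "q \<in> S")
      case True
      then have "\<sigma> q = (SOME r. r \<in> options R l q)"
        using is_kernelD[OF S] by (simp add: \<sigma>_def)
      then show ?thesis using ne by (simp add: some_in_eq)
    qed (use \<sigma>S in auto)
  qed
  have "odd (length ps)"
    if ps: "complete_play R l ps" "hd ps = p" "previous_follows \<sigma> ps" for ps
  proof -
    have ne: "ps \<noteq> []" and step: "\<And>i. Suc i < length ps \<Longrightarrow> ps ! Suc i \<in> options R l (ps ! i)"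
      and stuck: "options R l (last ps) = {}"
      using ps(1) by (auto simp: complete_play_def)
    have inv: "i < length ps \<Longrightarrow> ps ! i \<in> S \<longleftrightarrow> even i" for i
    proof (induction i)
      case 0
      then show ?case using ps(2) p ne by (simp add: hd_conv_nth)
    next
      case (Suc i)
      show ?case
      proof (cases "even i")
        case True
        then have "options R l (ps ! i) \<inter> S = {}" using Suc is_kernelD[OF S] by auto
        then show ?thesis using step[of i] Suc.prems True by auto
      next
        case False
        then have "ps ! i \<notin> S" "ps ! Suc i = \<sigma> (ps ! i)"
          using Suc ps(3) by (auto simp: previous_follows_def)
        then show ?thesis using \<sigma>S False by auto
      qed
    qed
    have "last ps \<in> S" using stuck is_kernelD[OF S] by blast
    then have "even (length ps - 1)" using inv[of "length ps - 1"] ne by (simp add: last_conv_nth)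
    then show ?thesis using ne by (cases ps) auto
  qed
  then show ?thesis unfolding P_position_def using legal by blast
qed

text \<open>The next player refutes any \<open>\<sigma>\<close> by moving into \<open>S\<close>,
  which \<open>\<sigma>\<close> must leave again. Prepending one such round of two positions
  preserves the parity of all indices.\<close>

lemma winning_play_outside_kernel:
  assumes R: "(0, 0) \<notin> R" and S: "is_kernel R l S" and \<sigma>: "legal_strategy R l \<sigma>" and "p \<notin> S"
  shows "\<exists>ps. complete_play R l ps \<and> hd ps = p \<and> previous_follows \<sigma> ps \<and> even (length ps)"
  using \<open>p \<notin> S\<close>
proof (induction "fst p + snd p" arbitrary: p rule: less_induct)
  case less
  obtain q where q: "q \<in> options R l p" "q \<in> S"
    using less.prems is_kernelD[OF S] by blast
  show ?case
  proof (cases "options R l q = {}")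
    case True
    then have "complete_play R l [p, q]" using q by (auto simp: complete_play_def)
    moreover have "previous_follows \<sigma> [p, q]" by (auto simp: previous_follows_def)
    ultimately show ?thesis by (intro exI[of _ "[p, q]"]) auto
  next
    case False
    then have r: "\<sigma> q \<in> options R l q" using \<sigma> unfolding legal_strategy_def by blast
    then have "\<sigma> q \<notin> S" using q is_kernelD[OF S] by blast
    moreover have "fst (\<sigma> q) + snd (\<sigma> q) < fst p + snd p"
      using options_decrease[OF R q(1)] options_decrease[OF R r] by simp
    ultimately obtain ps where ps: "complete_play R l ps" "hd ps = \<sigma> q"
      "previous_follows \<sigma> ps" "even (length ps)"
      using less.hyps by blast
    have ne: "ps \<noteq> []" using ps(1) by (simp add: complete_play_def)
    then have 0: "ps ! 0 = \<sigma> q" using ps(2) by (simp add: hd_conv_nth)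
    have "complete_play R l (p # q # ps)"
      using ps(1) ne 0 q r unfolding complete_play_def
      by (auto simp: nth_Cons split: nat.splits)
    moreover have "previous_follows \<sigma> (p # q # ps)"
      using ps(3) 0 unfolding previous_follows_def
      by (auto simp: nth_Cons split: nat.splits)
    ultimately show ?thesis using ps(4) by (intro exI[of _ "p # q # ps"]) auto
  qed
qed

lemma P_position_iff_kernel:
  assumes "(0, 0) \<notin> R" "is_kernel R l S"
  shows "P_position R l p \<longleftrightarrow> p \<in> S"
  using kernel_imp_P_position[OF assms(2)] winning_play_outside_kernel[OF assms]
  unfolding P_position_def by metis

text \<open>With unchanged P-positions, \<open>S\<close> would also be the kernel for
  \<open>R - {m}\<close>; but absorption fails there at \<open>p\<close>.\<close>

lemma not_redundant_if_unique:
  assumes R: "(0, 0) \<notin> R" and S: "is_kernel R l S" and p: "p \<notin> S"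
    and unique: "options (R - {m}) l p \<inter> S = {}"
  shows "\<not> redundant R l m"
proof
  assume "redundant R l m"
  then have eq: "P_position (R - {m}) l q \<longleftrightarrow> q \<in> S" for q
    using P_position_iff_kernel[OF R S] by (auto simp: redundant_def)
  have R': "(0, 0) \<notin> R - {m}" using R by simp
  obtain T where T: "is_kernel (R - {m}) l T" using kernel_exists[OF R'] by blast
  have "T = S" using eq P_position_iff_kernel[OF R' T] by auto
  then show False using is_kernelD[OF T] p unique by blast
qed

section \<open>The complementary sequences\<close>

text \<open>Greedy choice of the least integer above \<open>l\<close> not yet used. The condition
  says that \<open>lo l n + 1\<close> is a value of \<open>hi\<close>; indices beyond
  \<open>n\<close> give larger values. A jump of two is enough because values of \<open>hi\<close>
  are never consecutive.\<close>

fun lo :: "nat \<Rightarrow> nat \<Rightarrow> nat" where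
  "lo l 0 = l + 1"
| "lo l (Suc n) =
     (if \<exists>j\<in>{..n}. lo l j + (l + 1) + j = lo l n + 1 then lo l n + 2 else lo l n + 1)"

declare lo.simps(2) [simp del]

definition hi :: "nat \<Rightarrow> nat \<Rightarrow> nat" where
  "hi l n = lo l n + (l + 1) + n"

lemma lo_Suc:
  "lo l (Suc n) = (if \<exists>j\<le>n. hi l j = lo l n + 1 then lo l n + 2 else lo l n + 1)"
  by (auto simp: lo.simps(2) hi_def Bex_def)

lemma lo_Suc_cases:
  obtains "lo l (Suc n) = lo l n + 1"
  | j where "hi l j = lo l n + 1" "lo l (Suc n) = lo l n + 2"
  using that unfolding lo_Suc by metis

lemma lo_strict_mono: "strict_mono (lo l)"
  by (simp add: strict_mono_Suc_iff lo_Suc)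

lemma lo_less_iff [simp]: "lo l m < lo l n \<longleftrightarrow> m < n"
  using lo_strict_mono by (rule strict_mono_less)

lemma lo_eq_iff [simp]: "lo l m = lo l n \<longleftrightarrow> m = n"
  using lo_strict_mono by (rule strict_mono_eq)

lemma lo_gt: "l < lo l n"
  by (induction n) (auto simp: lo_Suc)

lemma hi_gap:
  assumes "m < n"
  shows "hi l m + 2 \<le> hi l n"
proof -
  have "lo l m < lo l n" using assms by simp
  then show ?thesis using assms unfolding hi_def by linarith
qed

lemma hi_eq_iff [simp]: "hi l m = hi l n \<longleftrightarrow> m = n"
  using hi_gap[of m n l] hi_gap[of n m l] by (cases m n rule: linorder_cases) auto

lemma hi_consecutive: "hi l m \<noteq> hi l n + 1"
  using hi_gap[of m n l] hi_gap[of n m l] by (cases m n rule: linorder_cases) auto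

lemma lo_less_hi: "lo l n < hi l n"
  by (simp add: hi_def)

text \<open>If \<open>n < m\<close>, the recursion for \<open>lo l m\<close> has already seen
  \<open>hi l n\<close>, and a jump lands just after a value of \<open>hi\<close>, which is not
  another one. Otherwise \<open>lo l m \<le> lo l n < hi l n\<close>.\<close>

lemma lo_neq_hi: "lo l m \<noteq> hi l n"
proof (cases "n < m")
  case True
  then obtain k where k: "m = Suc k" "n \<le> k" by (cases m) auto
  show ?thesis
  proof (cases "\<exists>j\<le>k. hi l j = lo l k + 1")
    case True
    then obtain j where "hi l j = lo l k + 1" by blast
    then show ?thesis using True k hi_consecutive[of l n j] by (auto simp: lo_Suc)
  next
    case False
    then show ?thesis using k by (auto simp: lo_Suc)
  qed
next
  case False
  then have "lo l m \<le> lo l n" using lo_less_iff[of l n m] by linarith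
  then show ?thesis using lo_less_hi[of l n] by simp
qed

lemma lo_hi_cover:
  assumes "l < x"
  shows "x \<in> range (lo l) \<or> x \<in> range (hi l)"
proof -
  have "l < x \<Longrightarrow> x \<le> lo l n \<Longrightarrow> x \<in> range (lo l) \<or> x \<in> range (hi l)" for n
  proof (induction n)
    case 0
    then have "x = lo l 0" by simp
    then show ?case by blast
  next
    case (Suc n)
    consider "x \<le> lo l n" | "x = lo l (Suc n)" | "x = lo l n + 1" "lo l (Suc n) = lo l n + 2"
      using Suc.prems(2) by (cases rule: lo_Suc_cases[of l n]) (fastforce simp: le_Suc_eq)+
    then show ?case
    proof cases
      case 3
      then have "\<exists>j. hi l j = x" by (cases rule: lo_Suc_cases[of l n]) auto
      then show ?thesis by blast
    qed (use Suc in blast)+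
  qed
  moreover have "x \<le> lo l x" using lo_strict_mono by (rule strict_mono_imp_increasing)
  ultimately show ?thesis using assms by blast
qed

lemma range_lo_iff: "l < x \<Longrightarrow> x \<in> range (lo l) \<longleftrightarrow> x \<notin> range (hi l)"
  by (metis lo_hi_cover lo_neq_hi rangeE)

lemma hi_gt: "l + 1 < hi l n"
  using lo_gt[of l n] by (simp add: hi_def)

lemma hi_neighbours:
  "hi l n - 1 \<in> range (lo l)" "hi l n + 1 \<in> range (lo l)"
proof -
  have "hi l n - 1 \<noteq> hi l j" "hi l n + 1 \<noteq> hi l j" for j
    using hi_consecutive[of l n j] hi_consecutive[of l j n] hi_gt[of l n] by linarith+
  then have "hi l n - 1 \<notin> range (hi l)" "hi l n + 1 \<notin> range (hi l)" by (metis rangeE)+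
  then show "hi l n - 1 \<in> range (lo l)" "hi l n + 1 \<in> range (lo l)"
    using hi_gt[of l n] by (auto simp: range_lo_iff)
qed

section \<open>The \<open>P\<close>-positions\<close>

definition P_set :: "nat \<Rightarrow> pos set" where
  "P_set l = terminal l \<union> range (\<lambda>n. (lo l n, hi l n)) \<union> range (\<lambda>n. (hi l n, lo l n))"

lemma P_set_swap: "(y, x) \<in> P_set l \<longleftrightarrow> (x, y) \<in> P_set l"
  by (auto simp: P_set_def terminal_def add.commute)

lemma P_set_iff:
  "(x, y) \<in> P_set l \<longleftrightarrow>
     x + y \<le> l \<or> (\<exists>n. x = lo l n \<and> y = hi l n) \<or> (\<exists>n. x = hi l n \<and> y = lo l n)"
  by (auto simp: P_set_def terminal_def)

text \<open>Options are described by their targets, with a set \<open>M\<close> of removed moves, so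
  that one characterization covers the full and the reduced rule-sets.\<close>

lemma mem_options_wythoff:
  "(x', y') \<in> options (wythoff_moves - M) l (x, y) \<longleftrightarrow> l < x + y \<and> x' \<le> x \<and> y' \<le> y \<and>
     (x - x', y - y') \<notin> M \<and> (x' < x \<and> y' = y \<or> x' = x \<and> y' < y \<or> x' < x \<and> x - x' = y - y')"
proof -
  have opt: "(x', y') \<in> options R l (x, y) \<longleftrightarrow>
    l < x + y \<and> x' \<le> x \<and> y' \<le> y \<and> (x - x', y - y') \<in> R" for R
    by (auto simp: options_def terminal_def) (metis diff_diff_cancel diff_le_self)+
  have moves: "(u, v) \<in> wythoff_moves \<longleftrightarrow> 0 < u \<and> v = 0 \<or> u = 0 \<and> 0 < v \<or> 0 < u \<and> u = v"
    for u v by (auto simp: wythoff_moves_def)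
  have "(x - x', y - y') \<in> wythoff_moves \<longleftrightarrow>
    x' < x \<and> y' = y \<or> x' = x \<and> y' < y \<or> x' < x \<and> x - x' = y - y'"
    if "x' \<le> x" "y' \<le> y"
    using that unfolding moves by arith
  then show ?thesis unfolding opt Diff_iff by blast
qed

lemmas mem_options_wythoff_full = mem_options_wythoff[where M = "{}", simplified]

lemma mem_options_swap:
  "(y', x') \<in> options wythoff_moves l (y, x) \<longleftrightarrow> (x', y') \<in> options wythoff_moves l (x, y)"
  by (auto simp: mem_options_wythoff_full)

lemma P_set_lo_column: "(lo l n, y) \<in> P_set l \<Longrightarrow> l < lo l n + y \<Longrightarrow> y = hi l n"
  by (auto simp: P_set_iff lo_neq_hi)

lemma P_set_hi_column: "(hi l n, y) \<in> P_set l \<Longrightarrow> y = lo l n"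
  using hi_gt[of l n] by (auto simp: P_set_iff lo_neq_hi[symmetric])

text \<open>The difference \<open>l + 1 + n\<close> determines the index, and it is too large for a
  terminal position.\<close>

lemma P_set_diagonal: "(x, x + (l + 1) + n) \<in> P_set l \<Longrightarrow> x = lo l n"
  by (auto simp: P_set_iff hi_def)

lemma P_set_independent:
  assumes "(x', y') \<in> options wythoff_moves l (lo l n, hi l n)"
  shows "(x', y') \<notin> P_set l"
proof
  assume P: "(x', y') \<in> P_set l"
  consider "x' < lo l n" "y' = hi l n" | "x' = lo l n" "y' < hi l n"
    | "x' < lo l n" "y' \<le> hi l n" "lo l n - x' = hi l n - y'"
    using assms by (auto simp: mem_options_wythoff_full)
  then show False
  proof cases
    case 1
    then show ?thesis using P P_set_hi_column[of l n x'] P_set_swap by auto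
  next
    case 2
    then show ?thesis using P P_set_lo_column[of l n y'] lo_gt[of l n] by auto
  next
    case 3
    then have "y' = x' + (l + 1) + n" by (auto simp: hi_def)
    then show ?thesis using P P_set_diagonal 3 by blast
  qed
qed

lemma P_set_absorbing:
  assumes "(x, y) \<notin> P_set l" "x \<le> y"
  shows "\<exists>q \<in> P_set l. q \<in> options wythoff_moves l (x, y)"
proof -
  have xy: "l < x + y" using assms by (auto simp: P_set_iff)
  show ?thesis
  proof (cases "x \<le> l")
    case True
    then have "(x, l - x) \<in> P_set l" "(x, l - x) \<in> options wythoff_moves l (x, y)"
      using xy by (auto simp: P_set_iff mem_options_wythoff_full)
    then show ?thesis by blast
  next
    case False
    then consider n where "x = lo l n" | n where "x = hi l n" using lo_hi_cover[of l x] by auto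
    then show ?thesis
    proof cases
      case (1 n)
      then have "y \<noteq> hi l n" using assms(1) by (auto simp: P_set_iff)
      \<comment> \<open>The three cases are answered by a vertical move to \<open>hi l n\<close>, a
        diagonal move to the terminal position \<open>(0, y - x)\<close>, and a diagonal move to the
        pair with index \<open>m\<close>.\<close>
      then consider "hi l n < y" | "y \<le> x + l" | m where "m < n" "y = x + (l + 1) + m"
      proof -
        assume a: "hi l n < y \<Longrightarrow> thesis" "y \<le> x + l \<Longrightarrow> thesis"
          "\<And>m. m < n \<Longrightarrow> y = x + (l + 1) + m \<Longrightarrow> thesis"
        show thesis
        proof (cases "hi l n < y \<or> y \<le> x + l")
          case False
          then show thesis
            using a(3)[of "y - (x + (l + 1))"] \<open>y \<noteq> hi l n\<close> 1 by (auto simp: hi_def)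
        qed (use a in auto)
      qed
      then show ?thesis
      proof cases
        case 1
        then have "(x, hi l n) \<in> options wythoff_moves l (x, y)" using xy by (simp add: mem_options_wythoff_full)
        then show ?thesis using \<open>x = lo l n\<close>
          by (intro bexI[of _ "(x, hi l n)"]) (auto simp: P_set_iff)
      next
        case 2
        then show ?thesis using False assms(2) xy
          by (intro bexI[of _ "(0, y - x)"]) (auto simp: P_set_iff mem_options_wythoff_full)
      next
        case (3 m)
        then have "lo l m < x" using \<open>x = lo l n\<close> by simp
        then have "(lo l m, hi l m) \<in> options wythoff_moves l (x, y)"
          using 3 xy by (simp add: mem_options_wythoff_full hi_def)
        then show ?thesis
          by (intro bexI[of _ "(lo l m, hi l m)"]) (auto simp: P_set_iff)
      qed
    next
      case (2 n)
      then have "(x, lo l n) \<in> options wythoff_moves l (x, y)"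
        using xy assms(2) lo_less_hi[of l n] by (simp add: mem_options_wythoff_full)
      then show ?thesis using 2
        by (intro bexI[of _ "(x, lo l n)"]) (auto simp: P_set_iff)
    qed
  qed
qed

lemma kernel_P_set: "is_kernel wythoff_moves l (P_set l)"
  unfolding is_kernel_def
proof (intro allI iffI)
  fix p assume p: "p \<in> P_set l"
  then consider "p \<in> terminal l" | n where "p = (lo l n, hi l n)" | n where "p = (hi l n, lo l n)"
    by (auto simp: P_set_def)
  then show "options wythoff_moves l p \<inter> P_set l = {}"
  proof cases
    case 1
    then show ?thesis by (auto simp: options_def)
  next
    case 2
    then show ?thesis using P_set_independent by auto
  next
    case 3
    then show ?thesis using P_set_independent mem_options_swap P_set_swap by fast
  qed
next
  fix p assume *: "options wythoff_moves l p \<inter> P_set l = {}"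
  obtain x y where p: "p = (x, y)" by (cases p)
  show "p \<in> P_set l"
  proof (rule ccontr)
    assume "p \<notin> P_set l"
    then have "\<exists>q \<in> P_set l. q \<in> options wythoff_moves l (x, y)"
      using P_set_absorbing[of x y l] P_set_absorbing[of y x l] p
      by (metis P_set_swap mem_options_swap nat_le_linear surj_pair)
    then show False using * p by auto
  qed
qed

section \<open>Factors of the characteristic word\<close>

text \<open>Words are Boolean lists; \<^const>\<open>True\<close> is the letter \<open>a\<close>.\<close>

primrec occurs :: "nat \<Rightarrow> nat \<Rightarrow> bool list \<Rightarrow> bool" where
  "occurs l x [] \<longleftrightarrow> True"
| "occurs l x (c # s) \<longleftrightarrow> (x \<in> range (lo l) \<longleftrightarrow> c) \<and> occurs l (Suc x) s"

primrec fib_morph :: "bool list \<Rightarrow> bool list" where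
  "fib_morph [] = []"
| "fib_morph (c # s) = (if c then [False, True] else [True]) @ fib_morph s"

text \<open>Iterates of \<open>s \<mapsto> a \<sigma>(s)\<close> from the empty word; each is a
  prefix of the next, so they are prefixes of the fixed point \<open>f\<close>.\<close>

primrec fib_word :: "nat \<Rightarrow> bool list" where
  "fib_word 0 = []"
| "fib_word (Suc k) = True # fib_morph (fib_word k)"

text \<open>
  In \<open>w = a\<^sup>l\<^sup>+\<^sup>1 \<sigma>(w)\<close> the image of the letter of \<open>w\<close> at \<open>x\<close> begins at \<open>image_pos l x\<close>.
\<close>

definition image_pos :: "nat \<Rightarrow> nat \<Rightarrow> nat" where
  "image_pos l x = x + (l + 1) + card {n. lo l n < x}"

lemma image_pos_lo: "image_pos l (lo l n) = hi l n"
  by (simp add: image_pos_def hi_def)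

lemma image_pos_Suc_lo: "image_pos l (Suc (lo l n)) = hi l n + 2"
proof -
  have "lo l m \<le> lo l n \<longleftrightarrow> m \<le> n" for m
    using lo_strict_mono by (rule strict_mono_less_eq)
  then have "{m. lo l m < Suc (lo l n)} = {..n}" by (auto simp: less_Suc_eq_le)
  then show ?thesis by (simp add: image_pos_def hi_def)
qed

text \<open>The word has no factor \<open>bb\<close> and begins with \<open>a\<close>, so each
  \<open>b\<close> stands between two letters \<open>a\<close>.\<close>

lemma not_lo_predecessor:
  assumes "l < x" "x \<notin> range (lo l)"
  obtains n where "x = Suc (lo l n)" "lo l (Suc n) = Suc x"
proof -
  obtain k where k: "x = hi l k" using assms lo_hi_cover[of l x] by auto
  then obtain n where n: "hi l k - 1 = lo l n" using hi_neighbours(1)[of l k] by auto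
  then have x: "x = Suc (lo l n)" using k hi_gt[of l k] by simp
  have "lo l (Suc n) \<noteq> x" using assms(2) by auto
  then have "lo l (Suc n) = Suc x" using x by (cases rule: lo_Suc_cases[of l n]) auto
  then show thesis using x that by blast
qed

lemma image_pos_Suc:
  assumes "l < x"
  shows "image_pos l (Suc x) = image_pos l x + (if x \<in> range (lo l) then 2 else 1)"
proof (cases "x \<in> range (lo l)")
  case True
  then show ?thesis by (auto simp: image_pos_lo image_pos_Suc_lo)
next
  case False
  then obtain n where n: "x = Suc (lo l n)" "lo l (Suc n) = Suc x"
    using not_lo_predecessor assms by blast
  have "image_pos l (Suc x) = hi l (Suc n)" using n(2) image_pos_lo by metis
  then show ?thesis using n False image_pos_Suc_lo[of l n] by (auto simp: hi_def)
qed

text \<open>\<open>\<sigma>(a) = ba\<close> and \<open>\<sigma>(b) = a\<close>. Both images end in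
  \<open>a\<close>, as does the initial block of letters \<open>a\<close>, so an \<open>a\<close>
  precedes every image.\<close>

lemma image_pos_letter:
  assumes "l < x"
  shows "image_pos l x \<in> range (lo l) \<longleftrightarrow> x \<notin> range (lo l)"
    and "x \<in> range (lo l) \<Longrightarrow> Suc (image_pos l x) \<in> range (lo l)"
    and "image_pos l x - 1 \<in> range (lo l)"
    and "l + 1 < image_pos l x"
proof -
  show "l + 1 < image_pos l x" using assms by (simp add: image_pos_def)
  have "(image_pos l x \<in> range (lo l) \<longleftrightarrow> x \<notin> range (lo l)) \<and> image_pos l x - 1 \<in> range (lo l) \<and>
    (x \<in> range (lo l) \<longrightarrow> Suc (image_pos l x) \<in> range (lo l))"
  proof (cases "x \<in> range (lo l)")
    case True
    then obtain n where "x = lo l n" by blast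
    moreover have "hi l n \<notin> range (lo l)" using lo_neq_hi[of l _ n] by (metis rangeE)
    ultimately show ?thesis using hi_neighbours[of l n] by (simp add: image_pos_lo)
  next
    case False
    then obtain n where n: "x = Suc (lo l n)" "lo l (Suc n) = Suc x"
      using not_lo_predecessor assms by blast
    have "hi l (Suc n) - 1 \<in> range (lo l)" by (rule hi_neighbours)
    \<comment> \<open>Skipping \<open>x\<close> makes \<open>lo\<close> jump by two, so
      \<open>hi\<close> jumps by three and two letters \<open>a\<close> lie in between; the image of
      the \<open>b\<close> at \<open>x\<close> is the second.\<close>
    moreover have "hi l (Suc n) - 1 = hi l n + 2" using n by (simp add: hi_def)
    ultimately show ?thesis
      using n(1) False image_pos_Suc_lo[of l n] hi_neighbours(2)[of l n] by simp
  qed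
  then show "image_pos l x \<in> range (lo l) \<longleftrightarrow> x \<notin> range (lo l)"
    "x \<in> range (lo l) \<Longrightarrow> Suc (image_pos l x) \<in> range (lo l)"
    "image_pos l x - 1 \<in> range (lo l)" by auto
qed

lemma occurs_nth: "occurs l x s \<Longrightarrow> k < length s \<Longrightarrow> x + k \<in> range (lo l) \<longleftrightarrow> s ! k"
proof (induction s arbitrary: x k)
  case (Cons c s)
  then show ?case by (cases k) (use Cons.IH[of "Suc x"] in auto)
qed simp

lemma occurs_fib_morph:
  assumes "l < x" "occurs l x s"
  shows "occurs l (image_pos l x) (fib_morph s)"
  using assms
proof (induction s arbitrary: x)
  case (Cons c s)
  then have "occurs l (image_pos l (Suc x)) (fib_morph s)" by simp
  then show ?case using Cons.prems image_pos_letter[of l x] image_pos_Suc[of l x]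
    by (auto simp: numeral_2_eq_2)
qed simp

lemma fib_morph_append: "fib_morph (s @ t) = fib_morph s @ fib_morph t"
  by (induction s) auto

lemma length_fib_morph: "length s \<le> length (fib_morph s)"
  by (induction s) auto

lemma length_fib_word: "k \<le> length (fib_word k)"
proof (induction k)
  case (Suc k)
  then show ?case using length_fib_morph[of "fib_word k"] by simp
qed simp

lemma fib_word_Suc_prefix: "\<exists>t. fib_word (Suc k) = fib_word k @ t"
proof (induction k)
  case (Suc k)
  then obtain t where "fib_word (Suc k) = fib_word k @ t" ..
  then have "fib_morph (fib_word (Suc k)) = fib_morph (fib_word k) @ fib_morph t"
    by (simp only: fib_morph_append)
  then show ?case by simp
qed simp

text \<open>The two patterns produce each other: the image of \<open>a u\<close>, with the
  \<open>a\<close> before it, is \<open>ab\<close> followed by \<open>a \<sigma>(u)\<close>; the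
  image of \<open>b u\<close>, the tail of \<open>ab u\<close>, with the \<open>a\<close> before it,
  is \<open>a\<close> followed by \<open>a \<sigma>(u)\<close>.\<close>

lemma occurs_fib_word:
  "(\<exists>n. occurs l (lo l n) (True # fib_word k)) \<and> (\<exists>n. occurs l (lo l n) (True # False # fib_word k))"
proof (induction k)
  case 0
  obtain n where n: "hi l 0 - 1 = lo l n" using hi_neighbours(1)[of l 0] by auto
  then have "Suc (lo l n) = hi l 0" using hi_gt[of l 0] by simp
  moreover have "hi l 0 \<notin> range (lo l)" using lo_neq_hi[of l _ 0] by (metis rangeE)
  ultimately have "occurs l (lo l n) (True # False # fib_word 0)" by simp
  then show ?case by auto
next
  case (Suc k)
  have lift: "\<exists>m. occurs l (lo l m) (True # fib_morph s)" if lx: "l < x" and occ: "occurs l x s" for x s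
  proof -
    obtain m where "image_pos l x - 1 = lo l m" using image_pos_letter(3)[OF lx] by auto
    moreover have "l + 1 < image_pos l x" using lx by (rule image_pos_letter(4))
    ultimately have "Suc (lo l m) = image_pos l x" by simp
    then have "occurs l (lo l m) (True # fib_morph s)" using occurs_fib_morph[OF lx occ] by simp
    then show ?thesis by blast
  qed
  obtain n where "occurs l (lo l n) (True # fib_word k)" using Suc by blast
  from lift[OF lo_gt this]
  have 1: "\<exists>m. occurs l (lo l m) (True # False # fib_word (Suc k))" by simp
  obtain n where "occurs l (lo l n) (True # False # fib_word k)" using Suc by blast
  then have "occurs l (Suc (lo l n)) (False # fib_word k)" by simp
  from lift[OF _ this] lo_gt[of l n]
  have "\<exists>m. occurs l (lo l m) (True # fib_word (Suc k))" by (simp add: less_SucI)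
  then show ?case using 1 by blast
qed

lemma lo_shift_exists:
  assumes "i \<ge> 1"
  shows "\<exists>n. lo l n + i \<in> range (lo l) \<and> hi l n + i \<in> range (lo l)"
proof -
  define k where "k = Suc i"
  have len: "i < length (fib_word k)" using length_fib_word[of k] by (simp add: k_def)
  have nth: "fib_word (Suc k) ! j = fib_word k ! j" "j < length (fib_word (Suc k))" if "j \<le> i" for j
    using fib_word_Suc_prefix[of k] len that by (auto simp del: fib_word.simps simp: nth_append)
  obtain n where n: "occurs l (lo l n) (True # fib_word k)" using occurs_fib_word by blast
  have "occurs l (hi l n) (fib_morph (True # fib_word k))"
    using occurs_fib_morph[OF lo_gt n] by (simp only: image_pos_lo)
  \<comment> \<open>The image of \<open>a\<close> is \<open>ba\<close>, whose \<open>a\<close>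
    starts the next iterate: after \<open>lo l n\<close> and after \<open>hi l n\<close> the same
    word is read.\<close>
  then have hn: "occurs l (Suc (hi l n)) (fib_word (Suc k))" by simp
  have an: "occurs l (Suc (lo l n)) (fib_word k)" using n by simp
  obtain m where m: "occurs l (lo l m) (True # False # fib_word k)" using occurs_fib_word by blast
  have "occurs l (hi l m) (fib_morph (True # False # fib_word k))"
    using occurs_fib_morph[OF lo_gt m] by (simp only: image_pos_lo)
  \<comment> \<open>The image of \<open>ab u\<close> is \<open>ba\<close> followed by
    \<open>a \<sigma>(u)\<close>, so here both readings of \<open>f\<close> start at distance
    two.\<close>
  then have hm: "occurs l (Suc (Suc (hi l m))) (fib_word (Suc k))" by simp
  have am: "occurs l (Suc (Suc (lo l m))) (fib_word k)" using m by simp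
  show ?thesis
  proof (cases "fib_word k ! (i - 1)")
    case True
    then show ?thesis
      using occurs_nth[OF an, of "i - 1"] occurs_nth[OF hn, of "i - 1"] len nth[of "i - 1"] assms
      by (intro exI[of _ n]) auto
  next
    case False
    \<comment> \<open>A \<open>b\<close> at index \<open>i - 1\<close> of \<open>f\<close> forces an
      \<open>a\<close> at index \<open>i - 2\<close>, and the occurrence at \<open>m\<close> shows
      this letter at distance \<open>i\<close>.\<close>
    have "fib_word k ! 0" by (simp add: k_def)
    then have i: "i \<ge> 2" using False assms by (cases "i = 1") auto
    have "lo l n + i \<notin> range (lo l)" using False occurs_nth[OF an, of "i - 1"] len assms by auto
    then obtain j where "lo l n + i = Suc (lo l j)"
      using not_lo_predecessor[of l "lo l n + i"] lo_gt[of l n] by auto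
    then have "Suc (lo l n) + (i - 2) = lo l j" using i by simp
    then have "fib_word k ! (i - 2)" using occurs_nth[OF an, of "i - 2"] len by auto
    then have "Suc (Suc (lo l m)) + (i - 2) \<in> range (lo l)"
      "Suc (Suc (hi l m)) + (i - 2) \<in> range (lo l)"
      using occurs_nth[OF am, of "i - 2"] occurs_nth[OF hm, of "i - 2"] len nth[of "i - 2"] by auto
    moreover have "Suc (Suc x) + (i - 2) = x + i" for x using i by simp
    ultimately show ?thesis by metis
  qed
qed

section \<open>No move is redundant\<close>

lemma P_set_hi_0_row:
  assumes "(x', y') \<in> P_set l" "l < x' + y'" "y' \<le> lo l 0"
  shows "x' = hi l 0 \<and> y' = lo l 0"
proof -
  consider n where "x' = lo l n" "y' = hi l n" | n where "x' = hi l n" "y' = lo l n"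
    using assms by (auto simp: P_set_iff)
  then show ?thesis
  proof cases
    case (1 n)
    then show ?thesis using assms(3) hi_gt[of l n] by simp
  next
    case (2 n)
    then have "n = 0" using assms(3) lo_less_iff[of l 0 n] by (cases n) (auto simp del: lo_less_iff)
    then show ?thesis using 2 by simp
  qed
qed

text \<open>Terminal positions are out of reach: a diagonal move subtracts at most
  \<open>lo l 0\<close>, and \<open>hi l 0 - lo l 0\<close> already exceeds
  \<open>l\<close>.\<close>

lemma P_set_hi_0_row_option:
  assumes P: "(x, y) \<in> P_set l" and opt: "x < hi l 0 + i \<and> y = lo l 0 \<or>
    x = hi l 0 + i \<and> y < lo l 0 \<or> x < hi l 0 + i \<and> y \<le> lo l 0 \<and> hi l 0 + i - x = lo l 0 - y"
  shows "x = hi l 0 \<and> y = lo l 0"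
proof (rule P_set_hi_0_row[OF P])
  show "l < x + y" using opt by (auto simp: hi_def)
  show "y \<le> lo l 0" using opt by auto
qed

lemma not_redundant_axis:
  assumes "i \<ge> 1"
  shows "\<not> redundant wythoff_moves l (i, 0)" "\<not> redundant wythoff_moves l (0, i)"
proof -
  have R: "(0, 0) \<notin> wythoff_moves" by (auto simp: wythoff_moves_def)
  have p: "(hi l 0 + i, lo l 0) \<notin> P_set l"
    using P_set_hi_0_row[of "hi l 0 + i" "lo l 0" l] assms by auto
  have "(x, y) \<notin> P_set l"
    if "(x, y) \<in> options (wythoff_moves - {(i, 0)}) l (hi l 0 + i, lo l 0)" for x y
  proof
    assume P: "(x, y) \<in> P_set l"
    have "x = hi l 0 \<and> y = lo l 0"
      using that unfolding mem_options_wythoff by (intro P_set_hi_0_row_option[OF P, of i]) blast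
    then show False using that unfolding mem_options_wythoff by simp
  qed
  then have "options (wythoff_moves - {(i, 0)}) l (hi l 0 + i, lo l 0) \<inter> P_set l = {}"
    by fast
  then show "\<not> redundant wythoff_moves l (i, 0)"
    using not_redundant_if_unique[OF R kernel_P_set p] by blast
  have p': "(lo l 0, hi l 0 + i) \<notin> P_set l" using p P_set_swap by blast
  have "(y, x) \<notin> P_set l"
    if "(y, x) \<in> options (wythoff_moves - {(0, i)}) l (lo l 0, hi l 0 + i)" for x y
  proof
    assume "(y, x) \<in> P_set l"
    then have P: "(x, y) \<in> P_set l" using P_set_swap by blast
    have "x = hi l 0 \<and> y = lo l 0"
      using that unfolding mem_options_wythoff
      by (intro P_set_hi_0_row_option[OF P, of i]) arith
    then show False using that unfolding mem_options_wythoff by simp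
  qed
  then have "options (wythoff_moves - {(0, i)}) l (lo l 0, hi l 0 + i) \<inter> P_set l = {}"
    by fast
  then show "\<not> redundant wythoff_moves l (0, i)"
    using not_redundant_if_unique[OF R kernel_P_set p'] by blast
qed

lemma not_redundant_diagonal:
  assumes "i \<ge> 1"
  shows "\<not> redundant wythoff_moves l (i, i)"
proof -
  have R: "(0, 0) \<notin> wythoff_moves" by (auto simp: wythoff_moves_def)
  \<comment> \<open>The test position is \<open>(lo l m, lo l k)\<close>. The P-positions in its
    column and row lie beyond it, since \<open>lo l k < hi l m\<close> and
    \<open>lo l m < hi l k\<close>; the only one on its diagonal is \<open>(lo l n, hi l n)\<close>,
    at distance \<open>i\<close>.\<close>
  obtain n m k where m: "lo l n + i = lo l m" and k: "hi l n + i = lo l k"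
    using lo_shift_exists[OF assms, of l] by (metis rangeE)
  have "lo l n < lo l m" "lo l m < lo l k" using m k assms lo_less_hi[of l n] by linarith+
  then have less: "n < m" "m < k" by simp_all
  have diff: "lo l k = lo l m + (l + 1) + n" using m k by (simp add: hi_def)
  have above: "lo l k < hi l m" "lo l m < hi l k"
    using diff less \<open>lo l m < lo l k\<close> by (auto simp: hi_def)
  have "lo l k \<noteq> hi l m" using above by simp
  then have p: "(lo l m, lo l k) \<notin> P_set l"
    using P_set_lo_column[of l m "lo l k"] lo_gt[of l m] by auto
  have "(x, y) \<notin> P_set l"
    if opt: "(x, y) \<in> options (wythoff_moves - {(i, i)}) l (lo l m, lo l k)" for x y
  proof
    assume P: "(x, y) \<in> P_set l"
    consider "x < lo l m" "y = lo l k" | "x = lo l m" "y < lo l k"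
      | "x < lo l m" "y \<le> lo l k" "lo l m - x = lo l k - y" "lo l m - x \<noteq> i"
      using opt by (auto simp: mem_options_wythoff)
    then show False
    proof cases
      case 1
      then have "x = hi l k" using P P_set_lo_column[of l k x] P_set_swap lo_gt[of l k] by auto
      then show False using above 1 by simp
    next
      case 2
      then have "y = hi l m" using P P_set_lo_column[of l m y] lo_gt[of l m] by auto
      then show False using above 2 by simp
    next
      case 3
      then have "y = x + (l + 1) + n" using diff by linarith
      then have "x = lo l n" using P P_set_diagonal by blast
      then show False using m 3 by simp
    qed
  qed
  then have "options (wythoff_moves - {(i, i)}) l (lo l m, lo l k) \<inter> P_set l = {}" by auto
  then show ?thesis using not_redundant_if_unique[OF R kernel_P_set p] by blast
qed

theorem theorem30:
  fixes l :: nat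
  assumes "l \<in> {1, 2, 3, 4}"
  shows "\<forall>m \<in> wythoff_moves. \<not> redundant wythoff_moves l m"
  using not_redundant_axis not_redundant_diagonal by (auto simp: wythoff_moves_def)

end
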